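(* Let $\zeta_1,\zeta_2\in wAC(P)$ and $\alpha\in\{0,1\}$. Then $\zeta_1\equiv\zeta_2$ if and only if $[\zeta_1]^{\alpha}\cong[\zeta_2]^{\alpha}$.
   Context: $(K,\oplus,\otimes,\hat0,\hat1)$ is a commutative, additively idempotent semiring; $P$ is a finite nonempty set of ports with $0,1\notin P$ and weights $k_p\in K$. $wAI(P)$ is the weighted Algebra of Interactions: terms $z::=0\mid1\mid p\mid z\oplus z\mid z\otimes z\mid(z)$, with semantics $\|z\|(\gamma)\in K$ for $\gamma\in\Gamma(P)=2^{2^P}$: $\|0\|(\gamma)=\hat0$; $\|1\|(\gamma)=\hat1$ iff $\emptyset\in\gamma$ (else $\hat0$); $\|p\|(\gamma)=k_p$ if some $a\in\gamma$ contains $p$ (else $\hat0$); $\|z_1\oplus z_2\|(\gamma)=\bigoplus_{a\in\gamma}(\|z_1\|(\{a\})\oplus\|z_2\|(\{a\}))$; $\|z_1\otimes z_2\|(\gamma)=\bigoplus_{a\in\gamma}\bigoplus_{a_1\cup a_2=a}(\|z_1\|(\{a_1\})\otimes\|z_2\|(\{a_2\}))$ (inner sum over pairs of possibly empty subsets of $P$); $\|(z)\|=\|z\|$. On $wAI(P)$, $z_1\equiv z_2$ iff $\|z_1\|=\|z_2\|$ on all of $\Gamma(P)$; $wAI(P)/\equiv$ is a commutative idempotent semiring under $\oplus,\otimes$ with zero $\overline0$ and one $\overline1$, and computations with $wAI(P)$ terms are done in it. The weighted Algebra of Connectors $wAC(Q)$ over a port set $Q$ has syntax: synchrons $\sigma::=[0]\mid[1]\mid[p]\mid[\zeta]$,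 triggers $\tau::=[0]'\mid[1]'\mid[p]'\mid[\zeta]'$ ($p\in Q$), and $\zeta::=\sigma\mid\tau\mid\zeta\oplus\zeta\mid\zeta\otimes\zeta$, where weighted fusion $\otimes$ is applied to typed connectors; $[\zeta]^{\alpha}$ is $[\zeta]$ if $\alpha=0$ and $[\zeta]'$ if $\alpha=1$. Semantics $|\cdot|$ into $wAI$: $|[p]|=|[p]'|=p$ for $p\in Q\cup\{0,1\}$; $|[\zeta]|=|[\zeta]'|=|\zeta|$; $|\zeta_1\oplus\zeta_2|=|\zeta_1|\oplus|\zeta_2|$; $|[\zeta_1]\otimes\cdots\otimes[\zeta_n]|=|\zeta_1|\otimes\cdots\otimes|\zeta_n|$; and if at least one $\alpha_i=1$, $|[\zeta_1]^{\alpha_1}\otimes\cdots\otimes[\zeta_n]^{\alpha_n}|=\bigoplus_{i:\alpha_i=1}\big(|\zeta_i|\otimes\bigotimes_{k\ne i,\alpha_k=1}(1\oplus|\zeta_k|)\otimes\bigotimes_{j:\alpha_j=0}(1\oplus|\zeta_j|)\big)$. Connectors are equivalent, $\zeta_1\equiv\zeta_2$, iff $|\zeta_1|\equiv|\zeta_2|$. The weighted congruence $\cong$ on $wAC(P)$ is the largest relation contained in $\equiv$ such that, for a fresh port $r\notin P$, $\zeta_1\cong\zeta_2$ implies $E(\zeta_1/r)\equiv E(\zeta_2/r)$ for every $E\in wAC(P\cup\{r\})$, where $E(\zeta/r)$ is obtained from $E$ by replacing every occurrence of the connector $r$ by $\zeta$. *)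

theory Defs
  imports Main
begin

section \<open>The weighted Algebra of Interactions\<close>

text \<open>The constants 0 and 1 are constructors, hence distinct from all ports.  Parentheses
  are implicit in the term structure.\<close>

datatype 'p wai =
    AZero
  | AOne
  | APort 'p
  | APlus "'p wai" "'p wai"
  | ATimes "'p wai" "'p wai"

primrec wai_sem ::
  "('p \<Rightarrow> 'k::{comm_semiring_0,comm_monoid_mult}) \<Rightarrow> 'p wai \<Rightarrow> 'p set set \<Rightarrow> 'k" where
  "wai_sem k AZero \<gamma> = 0"
| "wai_sem k AOne \<gamma> = (if {} \<in> \<gamma> then 1 else 0)"
| "wai_sem k (APort p) \<gamma> = (if \<exists>a\<in>\<gamma>. p \<in> a then k p else 0)"
| "wai_sem k (APlus z1 z2) \<gamma> = (\<Sum>a\<in>\<gamma>. wai_sem k z1 {a} + wai_sem k z2 {a})"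
| "wai_sem k (ATimes z1 z2) \<gamma> =
     (\<Sum>a\<in>\<gamma>. \<Sum>(a1, a2)\<in>{(a1, a2). a1 \<union> a2 = a}. wai_sem k z1 {a1} * wai_sem k z2 {a2})"

definition wai_equiv ::
  "'p set \<Rightarrow> ('p \<Rightarrow> 'k::{comm_semiring_0,comm_monoid_mult}) \<Rightarrow> 'p wai \<Rightarrow> 'p wai \<Rightarrow> bool" where
  "wai_equiv P k z1 z2 \<longleftrightarrow> (\<forall>\<gamma>. \<gamma> \<subseteq> Pow P \<longrightarrow> wai_sem k z1 \<gamma> = wai_sem k z2 \<gamma>)"

text \<open>Finite sums and products of terms; the choice of bracketing is immaterial modulo
  \<^const>\<open>wai_equiv\<close>.\<close>

fun wai_sum :: "'p wai list \<Rightarrow> 'p wai" where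
  "wai_sum [] = AZero"
| "wai_sum [z] = z"
| "wai_sum (z # y # zs) = APlus z (wai_sum (y # zs))"

fun wai_prod :: "'p wai list \<Rightarrow> 'p wai" where
  "wai_prod [] = AOne"
| "wai_prod [z] = z"
| "wai_prod (z # y # zs) = ATimes z (wai_prod (y # zs))"


section \<open>The weighted Algebra of Connectors\<close>

text \<open>\<open>Synchron\<close> is the typing exponent 0, \<open>Trigger\<close> the typing exponent 1.\<close>

datatype typing = Synchron | Trigger

text \<open>\<open>CZero \<alpha>\<close>, \<open>COne \<alpha>\<close>, \<open>CPort \<alpha> p\<close> and \<open>CTyped \<alpha> \<zeta>\<close> are the typed connectors
  obtained from 0, 1, a port \<open>p\<close> and a connector \<open>\<zeta>\<close>.\<close>

datatype 'p wac =
    CZero typing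
  | COne typing
  | CPort typing 'p
  | CTyped typing "'p wac"
  | CPlus "'p wac" "'p wac"
  | CFuse "'p wac" "'p wac"

primrec fusion_of_typed :: "'p wac \<Rightarrow> bool" where
  "fusion_of_typed (CZero \<alpha>) = True"
| "fusion_of_typed (COne \<alpha>) = True"
| "fusion_of_typed (CPort \<alpha> p) = True"
| "fusion_of_typed (CTyped \<alpha> \<zeta>) = True"
| "fusion_of_typed (CPlus \<zeta>1 \<zeta>2) = False"
| "fusion_of_typed (CFuse \<zeta>1 \<zeta>2) = (fusion_of_typed \<zeta>1 \<and> fusion_of_typed \<zeta>2)"

text \<open>Fusion is applied to typed connectors only; nested binary fusions stand for n-ary ones.\<close>

inductive_set wAC :: "'p set \<Rightarrow> 'p wac set" for Q :: "'p set" where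
  zero: "CZero \<alpha> \<in> wAC Q"
| one: "COne \<alpha> \<in> wAC Q"
| port: "p \<in> Q \<Longrightarrow> CPort \<alpha> p \<in> wAC Q"
| typed: "\<zeta> \<in> wAC Q \<Longrightarrow> CTyped \<alpha> \<zeta> \<in> wAC Q"
| plus: "\<zeta>1 \<in> wAC Q \<Longrightarrow> \<zeta>2 \<in> wAC Q \<Longrightarrow> CPlus \<zeta>1 \<zeta>2 \<in> wAC Q"
| fuse: "\<zeta>1 \<in> wAC Q \<Longrightarrow> \<zeta>2 \<in> wAC Q \<Longrightarrow> fusion_of_typed \<zeta>1 \<Longrightarrow> fusion_of_typed \<zeta>2
    \<Longrightarrow> CFuse \<zeta>1 \<zeta>2 \<in> wAC Q"

text \<open>Semantics of an n-ary fusion, given the types and the semantics of its arguments.\<close>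

definition fusion_sem :: "(typing \<times> 'p wai) list \<Rightarrow> 'p wai" where
  "fusion_sem xs =
     (let n = length xs; \<alpha> = (\<lambda>i. fst (xs ! i)); z = (\<lambda>i. snd (xs ! i)) in
      if \<forall>i<n. \<alpha> i = Synchron
      then wai_prod (map z [0..<n])
      else wai_sum
        [wai_prod (z i # [APlus AOne (z k). k \<leftarrow> [0..<n], k \<noteq> i \<and> \<alpha> k = Trigger]
                       @ [APlus AOne (z j). j \<leftarrow> [0..<n], \<alpha> j = Synchron]).
         i \<leftarrow> [0..<n], \<alpha> i = Trigger])"

text \<open>\<open>fusion_args \<zeta>\<close> lists the arguments that \<open>\<zeta>\<close> contributes to an enclosing fusion.
  If \<open>\<zeta>\<close> is a fusion of typed connectors, the outer list is a singleton.  Sums inside a fusion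
  lie outside \<^const>\<open>wAC\<close>, but substituting an untyped sum for a port can produce them; fusion then
  distributes over the sum, and the outer list ranges over the summands.\<close>

fun wac_sem :: "'p wac \<Rightarrow> 'p wai"
  and fusion_args :: "'p wac \<Rightarrow> (typing \<times> 'p wai) list list" where
  "wac_sem (CZero \<alpha>) = AZero"
| "wac_sem (COne \<alpha>) = AOne"
| "wac_sem (CPort \<alpha> p) = APort p"
| "wac_sem (CTyped \<alpha> \<zeta>) = wac_sem \<zeta>"
| "wac_sem (CPlus \<zeta>1 \<zeta>2) = APlus (wac_sem \<zeta>1) (wac_sem \<zeta>2)"
| "wac_sem (CFuse \<zeta>1 \<zeta>2) =
     wai_sum [fusion_sem (xs @ ys). xs \<leftarrow> fusion_args \<zeta>1, ys \<leftarrow> fusion_args \<zeta>2]"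
| "fusion_args (CZero \<alpha>) = [[(\<alpha>, AZero)]]"
| "fusion_args (COne \<alpha>) = [[(\<alpha>, AOne)]]"
| "fusion_args (CPort \<alpha> p) = [[(\<alpha>, APort p)]]"
| "fusion_args (CTyped \<alpha> \<zeta>) = [[(\<alpha>, wac_sem \<zeta>)]]"
| "fusion_args (CPlus \<zeta>1 \<zeta>2) = fusion_args \<zeta>1 @ fusion_args \<zeta>2"
| "fusion_args (CFuse \<zeta>1 \<zeta>2) = [xs @ ys. xs \<leftarrow> fusion_args \<zeta>1, ys \<leftarrow> fusion_args \<zeta>2]"

definition wac_equiv ::
  "'p set \<Rightarrow> ('p \<Rightarrow> 'k::{comm_semiring_0,comm_monoid_mult}) \<Rightarrow> 'p wac \<Rightarrow> 'p wac \<Rightarrow> bool" where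
  "wac_equiv P k \<zeta>1 \<zeta>2 \<longleftrightarrow> wai_equiv P k (wac_sem \<zeta>1) (wac_sem \<zeta>2)"

text \<open>The connector \<open>r\<close> is the synchron \<open>[r]\<close> with its brackets omitted, so \<open>\<zeta>\<close> replaces \<open>[r]\<close>
  including the brackets; the trigger \<open>[r]'\<close> becomes \<open>[\<zeta>]'\<close>.  Replacing \<open>[r]\<close> by \<open>[\<zeta>]\<close> is
  subsumed via contexts containing \<open>[[r]]\<close>.\<close>

primrec wac_subst :: "'p \<Rightarrow> 'p wac \<Rightarrow> 'p wac \<Rightarrow> 'p wac" where
  "wac_subst r \<zeta> (CZero \<alpha>) = CZero \<alpha>"
| "wac_subst r \<zeta> (COne \<alpha>) = COne \<alpha>"
| "wac_subst r \<zeta> (CPort \<alpha> p) =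
     (if p = r then (case \<alpha> of Synchron \<Rightarrow> \<zeta> | Trigger \<Rightarrow> CTyped Trigger \<zeta>) else CPort \<alpha> p)"
| "wac_subst r \<zeta> (CTyped \<alpha> E) = CTyped \<alpha> (wac_subst r \<zeta> E)"
| "wac_subst r \<zeta> (CPlus E1 E2) = CPlus (wac_subst r \<zeta> E1) (wac_subst r \<zeta> E2)"
| "wac_subst r \<zeta> (CFuse E1 E2) = CFuse (wac_subst r \<zeta> E1) (wac_subst r \<zeta> E2)"

text \<open>The defining condition is preserved by unions, so the union of all relations satisfying it
  is the largest one.\<close>

definition wac_cong ::
  "'p set \<Rightarrow> ('p \<Rightarrow> 'k::{comm_semiring_0,comm_monoid_mult}) \<Rightarrow> 'p \<Rightarrow> ('p wac \<times> 'p wac) set" where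
  "wac_cong P k r =
     \<Union>{R. R \<subseteq> wAC P \<times> wAC P \<and>
         (\<forall>(\<zeta>1, \<zeta>2)\<in>R. wac_equiv P k \<zeta>1 \<zeta>2 \<and>
            (\<forall>E\<in>wAC (insert r P). wac_equiv P k (wac_subst r \<zeta>1 E) (wac_subst r \<zeta>2 E)))}"

end

theory Submission imports Defs begin

text \<open>Contexts need not preserve equivalence of connectors, because an enclosing fusion sees the
  types of its arguments.  But the semantics of a fusion is built by \<open>\<oplus>\<close> and \<open>\<otimes>\<close> from the argument
  terms, in a pattern determined by the argument types alone.  Hence contexts preserve the finer
  relation that also requires the contributed arguments to agree in number, in type and, up to
  equivalence, in semantics.  Since \<open>[\<zeta>]\<^sup>\<alpha>\<close> contributes one argument, of type \<open>\<alpha>\<close> and with the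
  semantics of \<open>\<zeta>\<close>, the finer relation holds between \<open>[\<zeta>\<^sub>1]\<^sup>\<alpha>\<close> and \<open>[\<zeta>\<^sub>2]\<^sup>\<alpha>\<close> as soon as
  \<open>\<zeta>\<^sub>1 \<equiv> \<zeta>\<^sub>2\<close>.\<close>

lemma list_all2_filter_comprehension:
  assumes "\<And>x. x \<in> set xs \<Longrightarrow> Q x \<longleftrightarrow> Q' x"
    and "\<And>x. x \<in> set xs \<Longrightarrow> Q x \<Longrightarrow> R (f x) (g x)"
  shows "list_all2 R [f x. x \<leftarrow> xs, Q x] [g x. x \<leftarrow> xs, Q' x]"
  using assms
  by (intro concat_transfer[THEN rel_funD])
    (auto simp: list.rel_map intro!: list.rel_refl_strong)

lemma list_all2_product_comprehension:
  assumes "list_all2 A xs xs'" and "list_all2 B ys ys'"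
    and "\<And>x x' y y'. A x x' \<Longrightarrow> B y y' \<Longrightarrow> R (f x y) (g x' y')"
  shows "list_all2 R [f x y. x \<leftarrow> xs, y \<leftarrow> ys] [g x y. x \<leftarrow> xs', y \<leftarrow> ys']"
proof (rule concat_transfer[THEN rel_funD])
  have "list_all2 R (map (f x) ys) (map (g x') ys')" if "A x x'" for x x'
    unfolding list.rel_map using assms(2) by (rule list_all2_mono) (rule assms(3)[OF that])
  with assms(1) show "list_all2 (list_all2 R)
      (map (\<lambda>x. map (f x) ys) xs) (map (\<lambda>x. map (g x) ys') xs')"
    unfolding list.rel_map by (rule list_all2_mono)
qed

lemma list_all2_rel_prod_eq_iff:
  "list_all2 (rel_prod (=) R) xs ys \<longleftrightarrow>
     map fst xs = map fst ys \<and> list_all2 R (map snd xs) (map snd ys)"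
  by (auto simp: list_all2_conv_all_nth list_eq_iff_nth_eq rel_prod_sel)

lemma wai_equiv_refl [simp]: "wai_equiv P k z z"
  by (simp add: wai_equiv_def)

lemma wai_equiv_singletonD:
  assumes "wai_equiv P k z z'" and "a \<subseteq> P"
  shows "wai_sem k z {a} = wai_sem k z' {a}"
  using assms by (simp add: wai_equiv_def)

lemma wai_equiv_APlus:
  assumes "wai_equiv P k x x'" and "wai_equiv P k y y'"
  shows "wai_equiv P k (APlus x y) (APlus x' y')"
  unfolding wai_equiv_def wai_sem.simps
proof (intro allI impI sum.cong refl)
  fix \<gamma> a assume "\<gamma> \<subseteq> Pow P" and "a \<in> \<gamma>"
  then have "a \<subseteq> P" by blast
  then show "wai_sem k x {a} + wai_sem k y {a} = wai_sem k x' {a} + wai_sem k y' {a}"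
    by (simp add: assms[THEN wai_equiv_singletonD])
qed

lemma wai_equiv_ATimes:
  assumes "wai_equiv P k x x'" and "wai_equiv P k y y'"
  shows "wai_equiv P k (ATimes x y) (ATimes x' y')"
  unfolding wai_equiv_def wai_sem.simps
proof (intro allI impI sum.cong refl, clarify)
  fix \<gamma> a1 a2 assume "\<gamma> \<subseteq> Pow P" and "a1 \<union> a2 \<in> \<gamma>"
  then have "a1 \<subseteq> P" and "a2 \<subseteq> P" by blast+
  then show "wai_sem k x {a1} * wai_sem k y {a2} = wai_sem k x' {a1} * wai_sem k y' {a2}"
    by (simp add: assms[THEN wai_equiv_singletonD])
qed

lemma
  assumes "list_all2 (wai_equiv P k) xs ys"
  shows wai_equiv_wai_sum: "wai_equiv P k (wai_sum xs) (wai_sum ys)"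
    and wai_equiv_wai_prod: "wai_equiv P k (wai_prod xs) (wai_prod ys)"
proof -
  have "wai_equiv P k (wai_sum xs) (wai_sum ys) \<and> wai_equiv P k (wai_prod xs) (wai_prod ys)"
    using assms
  proof (induction rule: list_all2_induct)
    case (Cons x xs y ys)
    then show ?case
      by (cases xs; cases ys) (simp_all add: wai_equiv_APlus wai_equiv_ATimes)
  qed simp
  then show "wai_equiv P k (wai_sum xs) (wai_sum ys)"
    and "wai_equiv P k (wai_prod xs) (wai_prod ys)"
    by simp_all
qed

abbreviation fusion_arg_equiv ::
  "'p set \<Rightarrow> ('p \<Rightarrow> 'k::{comm_semiring_0,comm_monoid_mult})
    \<Rightarrow> typing \<times> 'p wai \<Rightarrow> typing \<times> 'p wai \<Rightarrow> bool" where
  "fusion_arg_equiv P k \<equiv> rel_prod (=) (wai_equiv P k)"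

definition trigger_summand :: "(typing \<times> 'p wai) list \<Rightarrow> nat \<Rightarrow> 'p wai" where
  "trigger_summand xs i =
     wai_prod (snd (xs ! i) #
       [APlus AOne (snd (xs ! k)). k \<leftarrow> [0..<length xs], k \<noteq> i \<and> fst (xs ! k) = Trigger] @
       [APlus AOne (snd (xs ! j)). j \<leftarrow> [0..<length xs], fst (xs ! j) = Synchron])"

lemma fusion_sem_eq:
  "fusion_sem xs =
     (if Trigger \<in> set (map fst xs)
      then wai_sum [trigger_summand xs i. i \<leftarrow> [0..<length xs], fst (xs ! i) = Trigger]
      else wai_prod (map snd xs))"
proof -
  have Synchron_iff: "\<beta> = Synchron \<longleftrightarrow> \<beta> \<noteq> Trigger" for \<beta>
    by (cases \<beta>) simp_all
  have synchrons: "(\<forall>i<length xs. fst (xs ! i) = Synchron) \<longleftrightarrow> Trigger \<notin> set (map fst xs)"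
    unfolding in_set_conv_nth by (auto simp: Synchron_iff)
  have sem: "map (\<lambda>i. snd (xs ! i)) [0..<length xs] = map snd xs"
    by (rule nth_equalityI) simp_all
  show ?thesis
    unfolding fusion_sem_def trigger_summand_def Let_def synchrons sem by simp
qed

lemma fusion_arg_equiv_nthD:
  assumes "list_all2 (fusion_arg_equiv P k) xs ys" and "i < length xs"
  shows "fst (xs ! i) = fst (ys ! i)" and "wai_equiv P k (snd (xs ! i)) (snd (ys ! i))"
  using list_all2_nthD[OF assms] by (simp_all add: rel_prod_sel)

lemma wai_equiv_trigger_summand:
  assumes args: "list_all2 (fusion_arg_equiv P k) xs ys" and "i < length xs"
  shows "wai_equiv P k (trigger_summand xs i) (trigger_summand ys i)"
  unfolding trigger_summand_def list_all2_lengthD[OF args, symmetric]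
  by (intro wai_equiv_wai_prod list.rel_intros list_all2_appendI list_all2_filter_comprehension)
    (simp_all add: wai_equiv_APlus assms(2) fusion_arg_equiv_nthD[OF args])

lemma wai_equiv_fusion_sem:
  assumes args: "list_all2 (fusion_arg_equiv P k) xs ys"
  shows "wai_equiv P k (fusion_sem xs) (fusion_sem ys)"
proof -
  have types: "map fst xs = map fst ys"
    and terms: "list_all2 (wai_equiv P k) (map snd xs) (map snd ys)"
    using args by (simp_all only: list_all2_rel_prod_eq_iff)
  have len: "length xs = length ys"
    using args by (rule list_all2_lengthD)
  have summands: "list_all2 (wai_equiv P k)
      [trigger_summand xs i. i \<leftarrow> [0..<length xs], fst (xs ! i) = Trigger]
      [trigger_summand ys i. i \<leftarrow> [0..<length ys], fst (ys ! i) = Trigger]"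
    unfolding len[symmetric] by (rule list_all2_filter_comprehension)
      (simp_all add: fusion_arg_equiv_nthD[OF args] wai_equiv_trigger_summand[OF args])
  show ?thesis
    unfolding fusion_sem_eq types
    using wai_equiv_wai_sum[OF summands] wai_equiv_wai_prod[OF terms] by simp
qed

definition wac_fusion_equiv ::
  "'p set \<Rightarrow> ('p \<Rightarrow> 'k::{comm_semiring_0,comm_monoid_mult}) \<Rightarrow> 'p wac \<Rightarrow> 'p wac \<Rightarrow> bool" where
  "wac_fusion_equiv P k \<zeta>1 \<zeta>2 \<longleftrightarrow> wac_equiv P k \<zeta>1 \<zeta>2 \<and>
     list_all2 (list_all2 (fusion_arg_equiv P k)) (fusion_args \<zeta>1) (fusion_args \<zeta>2)"

lemma wac_fusion_equiv_imp_wac_equiv: "wac_fusion_equiv P k \<zeta>1 \<zeta>2 \<Longrightarrow> wac_equiv P k \<zeta>1 \<zeta>2"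
  by (simp add: wac_fusion_equiv_def)

lemma wac_fusion_equiv_refl [simp]: "wac_fusion_equiv P k \<zeta> \<zeta>"
  by (auto simp: wac_fusion_equiv_def wac_equiv_def rel_prod_sel intro!: list.rel_refl)

lemma wac_equiv_CTyped [simp]:
  "wac_equiv P k (CTyped \<alpha> \<zeta>1) (CTyped \<beta> \<zeta>2) \<longleftrightarrow> wac_equiv P k \<zeta>1 \<zeta>2"
  by (simp add: wac_equiv_def)

lemma wac_fusion_equiv_CTyped [simp]:
  "wac_fusion_equiv P k (CTyped \<alpha> \<zeta>1) (CTyped \<alpha> \<zeta>2) \<longleftrightarrow> wac_equiv P k \<zeta>1 \<zeta>2"
  by (simp add: wac_fusion_equiv_def wac_equiv_def)

lemma wac_fusion_equiv_CPlus:
  assumes "wac_fusion_equiv P k \<zeta>1 \<zeta>1'" and "wac_fusion_equiv P k \<zeta>2 \<zeta>2'"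
  shows "wac_fusion_equiv P k (CPlus \<zeta>1 \<zeta>2) (CPlus \<zeta>1' \<zeta>2')"
  using assms
  by (simp add: wac_fusion_equiv_def wac_equiv_def wai_equiv_APlus list_all2_appendI)

lemma wac_fusion_equiv_CFuse:
  assumes "wac_fusion_equiv P k \<zeta>1 \<zeta>1'" and "wac_fusion_equiv P k \<zeta>2 \<zeta>2'"
  shows "wac_fusion_equiv P k (CFuse \<zeta>1 \<zeta>2) (CFuse \<zeta>1' \<zeta>2')"
proof -
  note product = list_all2_product_comprehension
    [OF assms[unfolded wac_fusion_equiv_def, THEN conjunct2]]
  have "list_all2 (wai_equiv P k)
      [fusion_sem (xs @ ys). xs \<leftarrow> fusion_args \<zeta>1, ys \<leftarrow> fusion_args \<zeta>2]
      [fusion_sem (xs @ ys). xs \<leftarrow> fusion_args \<zeta>1', ys \<leftarrow> fusion_args \<zeta>2']"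
    by (rule product) (intro wai_equiv_fusion_sem list_all2_appendI)
  moreover have "list_all2 (list_all2 (fusion_arg_equiv P k))
      [xs @ ys. xs \<leftarrow> fusion_args \<zeta>1, ys \<leftarrow> fusion_args \<zeta>2]
      [xs @ ys. xs \<leftarrow> fusion_args \<zeta>1', ys \<leftarrow> fusion_args \<zeta>2']"
    by (rule product) (rule list_all2_appendI)
  ultimately show ?thesis
    by (simp add: wac_fusion_equiv_def wac_equiv_def wai_equiv_wai_sum)
qed

lemma wac_fusion_equiv_wac_subst:
  assumes "wac_fusion_equiv P k \<zeta>1 \<zeta>2"
  shows "wac_fusion_equiv P k (wac_subst r \<zeta>1 E) (wac_subst r \<zeta>2 E)"
proof (induction E)
  case (CPort \<beta> p)
  from assms show ?case
    by (cases \<beta>) (simp_all add: wac_fusion_equiv_imp_wac_equiv)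
next
  case (CTyped \<beta> E)
  then show ?case
    by (simp add: wac_fusion_equiv_imp_wac_equiv)
qed (simp_all add: wac_fusion_equiv_CPlus wac_fusion_equiv_CFuse)

lemma wac_cong_iff:
  "(\<zeta>1, \<zeta>2) \<in> wac_cong P k r \<longleftrightarrow>
     \<zeta>1 \<in> wAC P \<and> \<zeta>2 \<in> wAC P \<and> wac_equiv P k \<zeta>1 \<zeta>2 \<and>
     (\<forall>E\<in>wAC (insert r P). wac_equiv P k (wac_subst r \<zeta>1 E) (wac_subst r \<zeta>2 E))"
  (is "_ \<longleftrightarrow> ?cong \<zeta>1 \<zeta>2")
proof
  assume "(\<zeta>1, \<zeta>2) \<in> wac_cong P k r"
  then show "?cong \<zeta>1 \<zeta>2"
    unfolding wac_cong_def by blast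
next
  assume "?cong \<zeta>1 \<zeta>2"
  then show "(\<zeta>1, \<zeta>2) \<in> wac_cong P k r"
    unfolding wac_cong_def by (intro UnionI[of "{(\<zeta>1, \<zeta>2)}"]) simp_all
qed

theorem theorem1:
  fixes P :: "'p set"
    and r :: 'p
    and k :: "'p \<Rightarrow> 'k::{comm_semiring_0,comm_monoid_mult}"
    and \<zeta>1 \<zeta>2 :: "'p wac"
    and \<alpha> :: typing
  assumes "\<And>x::'k. x + x = x"
    and "finite P" and "P \<noteq> {}" and "r \<notin> P"
    and "\<zeta>1 \<in> wAC P" and "\<zeta>2 \<in> wAC P"
  shows "wac_equiv P k \<zeta>1 \<zeta>2 \<longleftrightarrow> (CTyped \<alpha> \<zeta>1, CTyped \<alpha> \<zeta>2) \<in> wac_cong P k r"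
proof
  assume equiv: "wac_equiv P k \<zeta>1 \<zeta>2"
  then have "wac_fusion_equiv P k (CTyped \<alpha> \<zeta>1) (CTyped \<alpha> \<zeta>2)"
    by simp
  then have "wac_equiv P k (wac_subst r (CTyped \<alpha> \<zeta>1) E) (wac_subst r (CTyped \<alpha> \<zeta>2) E)" for E
    by (intro wac_fusion_equiv_imp_wac_equiv wac_fusion_equiv_wac_subst)
  with equiv show "(CTyped \<alpha> \<zeta>1, CTyped \<alpha> \<zeta>2) \<in> wac_cong P k r"
    by (simp add: wac_cong_iff wAC.typed assms(5,6))
next
  assume "(CTyped \<alpha> \<zeta>1, CTyped \<alpha> \<zeta>2) \<in> wac_cong P k r"
  then show "wac_equiv P k \<zeta>1 \<zeta>2"
    by (simp add: wac_cong_iff)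
qed

end
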